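(* Let $X_1,X_2,\dots$ be i.i.d. integer-valued random variables with common distribution function $F(x)=\mathbb P(X_1\le x)$, and let $X_{(n)}=\max_{1\le i\le n}X_i$. Suppose the support of $F$ is not bounded from above, and that for some $\gamma\in[0,1]$ $$\lim_{n\to+\infty}\frac{1-F(n+1)}{1-F(n)}=\gamma .$$ Then there exist two sequences $\{m_n\}\subset\mathbb N$ and $\{p_n\}\subset[0,1]$ such that, as $n\to\infty$: (1) if $\gamma=0$, then $\mathbb P(X_{(n)}=m_n)\sim p_n$ and $\mathbb P(X_{(n)}=m_n+1)\sim 1-p_n$; (2) if $\gamma\in(0,1)$, then for every $x\in\mathbb Z$, $\mathbb P(X_{(n)}\le m_n+x)\sim p_n^{\gamma^x}$; (3) if $\gamma=1$, then for every $x\in\mathbb Z$, $\mathbb P(X_{(n)}\le m_n+x)\sim p_n$. Moreover, in case (1) the sequences can be taken so that, in addition, there exists an increasing sequence $\{N_i\}_{i\in\mathbb N}\subset\mathbb N$ with $N_i-N_{i-1}\to\infty$ such that, for $n\notin\{N_i\}_{i\in\mathbb N}$ and $n\to\infty$, one has $p_{n+1}\le p_n$ (for all sufficiently large such $n$) and $p_{n+1}-p_n\to0$ (along such $n$).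
   Context: For sequences $a_n,b_n$, $a_n\sim b_n$ means $a_n/b_n\to1$ as $n\to\infty$. *)

theory Defs
  imports "HOL-Probability.Probability"
begin

text \<open>Only meaningful for \<open>n \<ge> 1\<close>: the value at \<open>n = 0\<close> is the unspecified \<open>Max {}\<close>.\<close>

definition sample_max :: "(nat \<Rightarrow> 'a \<Rightarrow> int) \<Rightarrow> nat \<Rightarrow> 'a \<Rightarrow> int" where
  "sample_max X n \<omega> = Max ((\<lambda>i. X i \<omega>) ` {1..n})"

text \<open>The support of a distribution function is its set of points of increase, equivalently
  the closed support of the associated measure on the real line; for an integer-valued variable
  these are the integers carrying positive mass.\<close>

definition df_support :: "(real \<Rightarrow> real) \<Rightarrow> real set" where
  "df_support F = {x. \<forall>\<epsilon>>0. F (x - \<epsilon>) < F (x + \<epsilon>)}"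

end

theory Submission
  imports Defs
begin

text \<open>
  Write \<open>t k = 1 - F k\<close>, so that the maximum is at most \<open>k\<close> with probability \<open>(1 - t k) ^ n\<close>,
  and take \<open>p n = (1 - t (m n)) ^ n\<close> throughout. For \<open>\<gamma> > 0\<close> let \<open>m n\<close> be the first \<open>k\<close> with
  \<open>n * t k \<le> 1\<close>: then \<open>n * ln (1 - t (m n))\<close> stays bounded, and \<open>ln (1 - t (m n + x))\<close> is
  asymptotically \<open>\<gamma> powi x\<close> times \<open>ln (1 - t (m n))\<close>. For \<open>\<gamma> = 0\<close> replace \<open>t k\<close> in the choice
  of \<open>m\<close> by the geometric mean \<open>u k = sqrt (t k * t (k + 1))\<close>. Since \<open>t\<close> decays
  superexponentially this forces \<open>n * t (m n - 1) \<longrightarrow> \<infinity>\<close> and \<open>n * t (m n + 1) \<longrightarrow> 0\<close>, so the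
  maximum concentrates on \<open>m n\<close> and \<open>m n + 1\<close>. Between jumps of \<open>m\<close> the sequence \<open>p\<close> is
  multiplied by \<open>1 - t (m n)\<close>, hence it decreases by at most \<open>t (m n)\<close>. As \<open>u\<close> eventually at
  least halves at each step, consecutive jump times \<open>N < N'\<close> satisfy \<open>N' - N \<ge> N - 1\<close>.
\<close>

section \<open>First index at which a vanishing sequence drops to 1/n, and the jumps of that
  index\<close>

text \<open>For positive \<open>u\<close> this is the generalised inverse of \<open>1 / u\<close> at
  \<open>n\<close>. The product form keeps \<open>n = 0\<close> harmless: the value there is
  0.\<close>

definition first_below :: "(nat \<Rightarrow> real) \<Rightarrow> nat \<Rightarrow> nat" where
  "first_below u n = (LEAST k. real n * u k \<le> 1)"

context
  fixes u :: "nat \<Rightarrow> real"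
  assumes u_pos: "\<And>k. u k > 0" and u_lim: "u \<longlonglongrightarrow> 0"
begin

lemma first_below_le: "real n * u (first_below u n) \<le> 1"
proof -
  have "(\<lambda>k. real n * u k) \<longlonglongrightarrow> real n * 0"
    by (intro tendsto_intros u_lim)
  then have "\<forall>\<^sub>F k in sequentially. real n * u k < 1"
    by (intro order_tendstoD(2)) auto
  then have "\<exists>k. real n * u k < 1"
    by (rule eventually_happens'[OF sequentially_bot])
  then obtain k where "real n * u k < 1" ..
  then show ?thesis
    unfolding first_below_def by (rule LeastI[OF less_imp_le])
qed

lemma less_first_below: "k < first_below u n \<Longrightarrow> real n * u k > 1"
  unfolding first_below_def by (auto dest: not_less_Least)

lemma first_below_mono: "mono (first_below u)"
proof
  fix n n' :: nat assume "n \<le> n'"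
  then have "real n * u (first_below u n') \<le> real n' * u (first_below u n')"
    by (intro mult_right_mono) (use u_pos less_imp_le in auto)
  then have "real n * u (first_below u n') \<le> 1"
    using first_below_le[of n'] by linarith
  then show "first_below u n \<le> first_below u n'"
    unfolding first_below_def[of u n] by (rule Least_le)
qed

lemma first_below_at_top: "filterlim (first_below u) at_top sequentially"
proof (subst filterlim_at_top, intro allI)
  fix K
  have "\<forall>\<^sub>F n in sequentially. \<forall>k\<in>{..<K}. 1 < real n * u k"
  proof (subst eventually_ball_finite_distrib, simp, intro ballI)
    fix k
    have "filterlim (\<lambda>n. u k * real n) at_top sequentially"
      by (intro filterlim_tendsto_pos_mult_at_top[OF tendsto_const u_pos] filterlim_real_sequentially)
    then show "\<forall>\<^sub>F n in sequentially. 1 < real n * u k"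
      by (simp add: filterlim_at_top_dense mult.commute)
  qed
  then show "\<forall>\<^sub>F n in sequentially. K \<le> first_below u n"
  proof eventually_elim
    case (elim n)
    then have "\<not> first_below u n < K"
      using first_below_le[of n] by force
    then show ?case
      by simp
  qed
qed

text \<open>A jump time is recorded as the last index before the change. At a jump \<open>n\<close>
  the value \<open>u (?m n)\<close> is at most \<open>1 / n\<close>; at the next jump
  \<open>n'\<close> the index has moved on, so \<open>u\<close> has at least halved, yet it still
  exceeds \<open>1 / (n' + 1)\<close>. Hence \<open>2 * n < n' + 1\<close>, and the gaps grow at
  least like the jump times themselves.\<close>

lemma first_below_jumps:
  assumes halving: "\<forall>\<^sub>F k in sequentially. u (Suc k) \<le> u k / 2" and dec: "decseq u"
  shows "\<exists>N :: nat \<Rightarrow> nat. strict_mono N \<and>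
      filterlim (\<lambda>i. real (N (Suc i)) - real (N i)) at_top sequentially \<and>
      range N = {n. first_below u (Suc n) \<noteq> first_below u n}"
proof -
  let ?m = "first_below u"
  define J where "J = {n. ?m (Suc n) \<noteq> ?m n}"
  have J_less: "?m n < ?m (Suc n)" if "n \<in> J" for n
    using that monoD[OF first_below_mono, of n "Suc n"] by (simp add: J_def)
  \<comment> \<open>With finitely many jumps the index would be eventually constant, but it
    diverges.\<close>
  have inf: "infinite J"
  proof
    assume "finite J"
    then obtain b where b: "\<And>n. n \<in> J \<Longrightarrow> n < b"
      by (metis finite_nat_set_iff_bounded)
    have const: "?m (b + i) = ?m b" for i
    proof (induction i)
      case (Suc i)
      have "b + i \<notin> J"
        using b by fastforce
      with Suc show ?case
        by (simp add: J_def)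
    qed simp
    have "\<forall>\<^sub>F n in sequentially. Suc (?m b) \<le> ?m n"
      using first_below_at_top by (simp add: filterlim_at_top)
    then obtain c where "\<And>n. n \<ge> c \<Longrightarrow> Suc (?m b) \<le> ?m n"
      by (auto simp: eventually_sequentially)
    from this[of "b + c"] const[of c] show False
      by simp
  qed
  define N where "N = enumerate J"
  have mono: "strict_mono N" and ran: "range N = J"
    using inf by (auto simp: N_def strict_mono_enumerate range_enumerate)
  have "filterlim N at_top sequentially"
    using mono by (rule filterlim_subseq)
  have "\<forall>\<^sub>F n in sequentially. u (Suc (?m n)) \<le> u (?m n) / 2"
    using halving first_below_at_top by (rule eventually_compose_filterlim)
  then have ev: "\<forall>\<^sub>F i in sequentially. u (Suc (?m (N i))) \<le> u (?m (N i)) / 2"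
    using \<open>filterlim N at_top sequentially\<close> by (rule eventually_compose_filterlim)
  have gap: "real (N i) - 1 \<le> real (N (Suc i)) - real (N i)"
    if h: "u (Suc (?m (N i))) \<le> u (?m (N i)) / 2" for i
  proof -
    define n n' where "n = N i" and "n' = N (Suc i)"
    have "n < n'"
      using mono by (simp add: n_def n'_def strict_mono_Suc_iff)
    have "n \<in> J" "n' \<in> J"
      using ran by (auto simp: n_def n'_def)
    have "?m n < ?m (Suc n)"
      using \<open>n \<in> J\<close> by (rule J_less)
    also have "?m (Suc n) \<le> ?m n'"
      using \<open>n < n'\<close> by (intro monoD[OF first_below_mono]) simp
    finally have "u (?m n') \<le> u (Suc (?m n))"
      using dec by (auto simp: decseq_def)
    then have *: "u (?m n') \<le> u (?m n) / 2"
      using h by (simp add: n_def)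
    \<comment> \<open>The index leaves \<open>?m n'\<close> at time \<open>Suc n'\<close>, so by
      minimality \<open>?m n'\<close> fails the defining inequality there.\<close>
    have "?m n' < ?m (Suc n')"
      using \<open>n' \<in> J\<close> by (rule J_less)
    then have "1 < real (Suc n') * u (?m n')"
      by (rule less_first_below)
    also have "\<dots> \<le> real (Suc n') * (u (?m n) / 2)"
      using * by (intro mult_left_mono) auto
    finally have "real n * u (?m n) < (real (Suc n') / 2) * u (?m n)"
      using first_below_le[of n] by simp
    then have "real n < real (Suc n') / 2"
      using u_pos by (simp only: mult_less_cancel_right_pos)
    then show ?thesis
      by (simp add: n_def n'_def)
  qed
  have "filterlim (\<lambda>i. real (N i)) at_top sequentially"
    using filterlim_real_sequentially \<open>filterlim N at_top sequentially\<close> by (rule filterlim_compose)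
  then have "filterlim (\<lambda>i. - 1 + real (N i)) at_top sequentially"
    by (intro filterlim_tendsto_add_at_top[OF tendsto_const])
  then have "filterlim (\<lambda>i. real (N (Suc i)) - real (N i)) at_top sequentially"
  proof (rule filterlim_at_top_mono)
    show "\<forall>\<^sub>F i in sequentially. - 1 + real (N i) \<le> real (N (Suc i)) - real (N i)"
      using ev by eventually_elim (use gap in simp)
  qed
  with mono ran show ?thesis
    unfolding J_def by blast
qed

end

section \<open>Limits of shifted ratios and of the logarithm near 1\<close>

text \<open>Forward shifts telescope into a product of consecutive ratios; backward shifts are
  reciprocals of forward ones after reindexing. The truncation by \<open>nat\<close> affects only
  finitely many \<open>k\<close>.\<close>

lemma ratio_powi_shift:
  fixes f :: "nat \<Rightarrow> real"
  assumes nz: "\<forall>\<^sub>F k in sequentially. f k \<noteq> 0" and "\<gamma> \<noteq> 0"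
    and lim: "(\<lambda>k. f (Suc k) / f k) \<longlonglongrightarrow> \<gamma>"
  shows "(\<lambda>k. f (nat (int k + x)) / f k) \<longlonglongrightarrow> \<gamma> powi x"
proof -
  have shift: "(\<lambda>k. f (k + j) / f k) \<longlonglongrightarrow> \<gamma> ^ j" for j
  proof (induction j)
    case 0
    have "\<forall>\<^sub>F k in sequentially. f (k + 0) / f k = \<gamma> ^ 0"
      using nz by eventually_elim simp
    then show ?case
      by (rule tendsto_eventually)
  next
    case (Suc j)
    have "(\<lambda>k. f (Suc (k + j)) / f (k + j) * (f (k + j) / f k)) \<longlonglongrightarrow> \<gamma> * \<gamma> ^ j"
      using LIMSEQ_ignore_initial_segment[OF lim, of j] Suc by (rule tendsto_mult)
    moreover have "\<forall>\<^sub>F k in sequentially. f (k + j) \<noteq> 0"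
      by (rule eventually_sequentially_seg[of "\<lambda>k. f k \<noteq> 0" j, THEN iffD2, OF nz])
    then have "\<forall>\<^sub>F k in sequentially.
        f (Suc (k + j)) / f (k + j) * (f (k + j) / f k) = f (k + Suc j) / f k"
      by eventually_elim simp
    ultimately show ?case
      unfolding power_Suc by (rule Lim_transform_eventually)
  qed
  show ?thesis
  proof (cases "x \<ge> 0")
    case True
    then have "nat (int k + x) = k + nat x" for k
      by auto
    with shift[of "nat x"] True show ?thesis
      by (simp add: power_int_def)
  next
    case False
    define j where "j = nat (- x)"
    have x: "x = - int j"
      using False by (simp add: j_def)
    have "(\<lambda>k. inverse (f (k + j) / f k)) \<longlonglongrightarrow> inverse (\<gamma> ^ j)"
      using shift \<open>\<gamma> \<noteq> 0\<close> by (intro tendsto_inverse) auto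
    \<comment> \<open>Evaluated at \<open>k + j\<close>, the backward shift lands exactly on
      \<open>k\<close>, so nothing is truncated.\<close>
    then have "(\<lambda>k. f (nat (int (k + j) + x)) / f (k + j)) \<longlonglongrightarrow> \<gamma> powi x"
      by (simp add: x power_int_minus)
    then show ?thesis
      by (rule LIMSEQ_offset)
  qed
qed

text \<open>The quotient is the difference quotient of \<open>ln (1 - x)\<close> at 0, sampled along
  \<open>t\<close>.\<close>

lemma ln_one_minus_over_self:
  fixes t :: "nat \<Rightarrow> real"
  assumes "\<And>k. t k > 0" "t \<longlonglongrightarrow> 0"
  shows "(\<lambda>k. ln (1 - t k) / t k) \<longlonglongrightarrow> - 1"
proof -
  have "((\<lambda>x::real. ln (1 - x)) has_real_derivative - 1) (at 0)"
    by (auto intro!: derivative_eq_intros)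
  then have "((\<lambda>x::real. ln (1 - x) / x) \<longlongrightarrow> - 1) (at 0)"
    by (simp add: DERIV_def)
  moreover have "filterlim t (at 0) sequentially"
    using assms by (intro filterlim_atI) (auto simp: less_imp_neq[THEN not_sym])
  ultimately show ?thesis
    by (rule filterlim_compose)
qed

section \<open>Powers of \<open>1 - t k\<close> for a tail sequence \<open>t\<close>, with the case
  of positive \<gamma> first\<close>

context
  fixes t :: "nat \<Rightarrow> real" and \<gamma> :: real
  assumes t_pos: "\<And>k. t k > 0" and t_le: "\<And>k. t k \<le> 1" and t_dec: "decseq t"
    and t_lim: "t \<longlonglongrightarrow> 0"
    and ratio: "(\<lambda>k. t (Suc k) / t k) \<longlonglongrightarrow> \<gamma>"
begin

lemma ln_ratio: "(\<lambda>k. ln (1 - t (Suc k)) / ln (1 - t k)) \<longlonglongrightarrow> \<gamma>"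
proof -
  let ?q = "\<lambda>k. ln (1 - t k) / t k"
  have q: "?q \<longlonglongrightarrow> - 1"
    using t_pos t_lim by (rule ln_one_minus_over_self)
  have "(\<lambda>k. ?q (Suc k) / ?q k * (t (Suc k) / t k)) \<longlonglongrightarrow> (- 1) / (- 1) * \<gamma>"
    using q ratio LIMSEQ_Suc[OF q] by (intro tendsto_intros) auto
  moreover have "?q (Suc k) / ?q k * (t (Suc k) / t k) = ln (1 - t (Suc k)) / ln (1 - t k)" for k
    using t_pos[of k] t_pos[of "Suc k"] by (simp add: field_simps)
  ultimately show ?thesis
    by simp
qed

text \<open>The quotient is the exponential of \<open>n\<close> times
  \<open>l (m n + x) - \<gamma> powi x * l (m n)\<close>. This difference is of smaller order than
  \<open>t (m n)\<close>, and \<open>n * t (m n)\<close> is at most 1 by the choice of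
  \<open>m\<close>, so the exponent vanishes in the limit.\<close>

lemma power_shift_asymp:
  assumes "\<gamma> > 0"
  defines "m \<equiv> first_below t"
  shows "(\<lambda>n. (1 - t (nat (int (m n) + x))) ^ n / ((1 - t (m n)) ^ n) powr (\<gamma> powi x)) \<longlonglongrightarrow> 1"
proof -
  define l where "l k = ln (1 - t k)" for k
  have m: "filterlim m at_top sequentially"
    unfolding m_def by (rule first_below_at_top[OF t_pos t_lim])
  \<comment> \<open>\<open>t k = 1\<close> is possible for small \<open>k\<close>, so the logarithms
    are meaningful only eventually.\<close>
  have small: "\<forall>\<^sub>F k in sequentially. t k < 1"
    using t_lim by (rule order_tendstoD) simp
  have l_nz: "\<forall>\<^sub>F k in sequentially. l k \<noteq> 0"
    using small by eventually_elim (use t_pos in \<open>auto simp: l_def less_imp_neq[THEN not_sym]\<close>)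
  have "(\<lambda>k. l (nat (int k + x)) / l k) \<longlonglongrightarrow> \<gamma> powi x"
    using l_nz \<open>\<gamma> > 0\<close> ln_ratio by (intro ratio_powi_shift) (auto simp: l_def)
  then have "(\<lambda>k. l (nat (int k + x)) / l k - \<gamma> powi x) \<longlonglongrightarrow> 0"
    by (simp add: LIM_zero_iff)
  moreover have "(\<lambda>k. l k / t k) \<longlonglongrightarrow> - 1"
    unfolding l_def using t_pos t_lim by (rule ln_one_minus_over_self)
  ultimately have "(\<lambda>k. l k / t k * (l (nat (int k + x)) / l k - \<gamma> powi x)) \<longlonglongrightarrow> - 1 * 0"
    by (intro tendsto_mult)
  then have "(\<lambda>k. l k / t k * (l (nat (int k + x)) / l k - \<gamma> powi x)) \<longlonglongrightarrow> 0"
    by simp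
  moreover have "\<forall>\<^sub>F k in sequentially. l k / t k * (l (nat (int k + x)) / l k - \<gamma> powi x) =
      (l (nat (int k + x)) - \<gamma> powi x * l k) / t k"
    using l_nz
  proof eventually_elim
    case (elim k)
    then show ?case
      using t_pos[of k] by (simp add: divide_simps)
  qed
  ultimately have "(\<lambda>k. (l (nat (int k + x)) - \<gamma> powi x * l k) / t k) \<longlonglongrightarrow> 0"
    by (rule Lim_transform_eventually)
  then have E: "(\<lambda>n. (l (nat (int (m n) + x)) - \<gamma> powi x * l (m n)) / t (m n)) \<longlonglongrightarrow> 0"
    using m by (rule filterlim_compose)
  have "(\<lambda>n. real n * t (m n) *
      ((l (nat (int (m n) + x)) - \<gamma> powi x * l (m n)) / t (m n))) \<longlonglongrightarrow> 0"
  proof (rule Lim_null_comparison[OF always_eventually tendsto_norm_zero[OF E]], intro allI)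
    fix n
    have "\<bar>real n * t (m n)\<bar> \<le> 1"
      using first_below_le[OF t_pos t_lim, of n] t_pos[of "m n"] by (simp add: m_def)
    then have "\<bar>real n * t (m n)\<bar> * \<bar>z\<bar> \<le> \<bar>z\<bar>" for z :: real
      using mult_right_mono[of _ 1 "\<bar>z\<bar>"] by force
    then show "norm (real n * t (m n) * ((l (nat (int (m n) + x)) - \<gamma> powi x * l (m n)) / t (m n)))
        \<le> norm ((l (nat (int (m n) + x)) - \<gamma> powi x * l (m n)) / t (m n))"
      unfolding real_norm_def abs_mult[of "real n * t (m n)"] .
  qed
  moreover have "real n * t (m n) * ((l (nat (int (m n) + x)) - \<gamma> powi x * l (m n)) / t (m n)) =
      real n * (l (nat (int (m n) + x)) - \<gamma> powi x * l (m n))" for n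
    using t_pos[of "m n"] by simp
  ultimately have "(\<lambda>n. exp (real n * (l (nat (int (m n) + x)) - \<gamma> powi x * l (m n)))) \<longlonglongrightarrow> exp 0"
    by (intro tendsto_exp) simp
  then have "(\<lambda>n. exp (real n * (l (nat (int (m n) + x)) - \<gamma> powi x * l (m n)))) \<longlonglongrightarrow> 1"
    by simp
  moreover have "\<forall>\<^sub>F n in sequentially. exp (real n * (l (nat (int (m n) + x)) - \<gamma> powi x * l (m n))) =
      (1 - t (nat (int (m n) + x))) ^ n / ((1 - t (m n)) ^ n) powr (\<gamma> powi x)"
  proof -
    have "filterlim (\<lambda>n. nat (int (m n) + x)) at_top sequentially"
    proof (subst filterlim_at_top, intro allI)
      fix K
      have "\<forall>\<^sub>F n in sequentially. K + nat \<bar>x\<bar> \<le> m n"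
        using m by (simp add: filterlim_at_top)
      then show "\<forall>\<^sub>F n in sequentially. K \<le> nat (int (m n) + x)"
        by eventually_elim linarith
    qed
    from eventually_compose_filterlim[OF small this] eventually_compose_filterlim[OF small m]
    show ?thesis
    proof eventually_elim
      case (elim n)
      then show ?case
        by (simp add: l_def powr_def exp_diff right_diff_distrib ln_realpow exp_of_nat_mult
            mult.left_commute[of "real n"] mult.assoc mult.commute)
    qed
  qed
  ultimately show ?thesis
    by (rule Lim_transform_eventually)
qed

section \<open>The case of ratio limit 0: concentration on two neighbouring points\<close>

context
  fixes m :: "nat \<Rightarrow> nat" and u :: "nat \<Rightarrow> real"
  assumes \<gamma>: "\<gamma> = 0"
  defines "u \<equiv> \<lambda>k. sqrt (t k * t (Suc k))"
  defines "m \<equiv> first_below u"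
begin

lemma consecutive_gmean_pos: "u k > 0"
  using t_pos by (simp add: u_def)

lemma consecutive_gmean_lim: "u \<longlonglongrightarrow> 0"
proof -
  have "u \<longlonglongrightarrow> sqrt (0 * 0)"
    unfolding u_def by (intro tendsto_intros t_lim LIMSEQ_Suc[OF t_lim])
  then show ?thesis
    by simp
qed

lemma consecutive_gmean_dec: "decseq u"
proof (rule decseq_SucI)
  fix k
  have "t (Suc k) * t (Suc (Suc k)) \<le> t k * t (Suc k)"
    using t_pos less_imp_le by (intro mult_mono decseq_SucD[OF t_dec]) auto
  then show "u (Suc k) \<le> u k"
    by (simp add: u_def)
qed

lemma ratio_eventually_le:
  assumes "\<epsilon> > 0"
  shows "\<forall>\<^sub>F k in sequentially. t (Suc k) \<le> \<epsilon> * t k"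
proof -
  have "\<forall>\<^sub>F k in sequentially. t (Suc k) / t k < \<epsilon>"
    using ratio assms \<gamma> by (intro order_tendstoD(2)) auto
  then show ?thesis
    by eventually_elim (use t_pos in \<open>simp add: divide_less_eq less_imp_le\<close>)
qed

text \<open>Both factors under the root eventually at least halve. This supplies the hypothesis of
  \<open>first_below_jumps\<close>.\<close>

lemma consecutive_gmean_halving: "\<forall>\<^sub>F k in sequentially. u (Suc k) \<le> u k / 2"
proof -
  have r: "\<forall>\<^sub>F k in sequentially. t (Suc k) \<le> 1/2 * t k"
    by (rule ratio_eventually_le) simp
  moreover have "\<forall>\<^sub>F k in sequentially. t (Suc (Suc k)) \<le> 1/2 * t (Suc k)"
    using r by (subst eventually_sequentially_Suc)
  ultimately show ?thesis
  proof eventually_elim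
    case (elim k)
    have "u (Suc k) \<le> sqrt ((1/2 * t k) * (1/2 * t (Suc k)))"
      unfolding u_def by (intro real_sqrt_le_mono mult_mono elim) (use t_pos less_imp_le in auto)
    also have "\<dots> = sqrt ((1/2)\<^sup>2 * (t k * t (Suc k)))"
      by (simp add: power2_eq_square mult_ac)
    also have "\<dots> = u k / 2"
      by (simp add: u_def real_sqrt_mult)
    finally show ?case .
  qed
qed

lemma gmean_index_at_top: "filterlim m at_top sequentially"
  unfolding m_def by (rule first_below_at_top[OF consecutive_gmean_pos consecutive_gmean_lim])

lemma gmean_index_jumps: "\<exists>N :: nat \<Rightarrow> nat. strict_mono N \<and>
      filterlim (\<lambda>i. real (N (Suc i)) - real (N i)) at_top sequentially \<and>
      range N = {n. m (Suc n) \<noteq> m n}"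
  unfolding m_def
  by (rule first_below_jumps[OF consecutive_gmean_pos consecutive_gmean_lim
      consecutive_gmean_halving consecutive_gmean_dec])

text \<open>With \<open>k = m n\<close>, \<open>t (k + 1)\<close> is \<open>u k\<close> times the
  root of the ratio \<open>t (k + 1) / t k\<close>. The choice of \<open>m\<close> bounds
  \<open>n * u k\<close> by 1, and the root tends to 0.\<close>

lemma tail_above_gmean_index: "(\<lambda>n. real n * t (Suc (m n))) \<longlonglongrightarrow> 0"
proof -
  have "(\<lambda>k. sqrt (t (Suc k) / t k)) \<longlonglongrightarrow> sqrt 0"
    using ratio \<gamma> by (intro tendsto_intros) simp
  then have "(\<lambda>n. sqrt (t (Suc (m n)) / t (m n))) \<longlonglongrightarrow> sqrt 0"
    using gmean_index_at_top by (rule filterlim_compose)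
  then have *: "(\<lambda>n. sqrt (t (Suc (m n)) / t (m n))) \<longlonglongrightarrow> 0"
    by simp
  show ?thesis
  proof (rule Lim_null_comparison[OF always_eventually *], intro allI)
    fix n
    let ?k = "m n"
    have "t (Suc ?k) = u ?k * sqrt (t (Suc ?k) / t ?k)"
      unfolding u_def using t_pos[of ?k] t_pos[of "Suc ?k"]
      by (simp flip: real_sqrt_mult)
    then have "real n * t (Suc ?k) = (real n * u ?k) * sqrt (t (Suc ?k) / t ?k)"
      by simp
    also have "\<dots> \<le> 1 * sqrt (t (Suc ?k) / t ?k)"
      using first_below_le[OF consecutive_gmean_pos consecutive_gmean_lim, of n] t_pos[of ?k] t_pos[of "Suc ?k"]
      by (intro mult_right_mono) (simp_all add: m_def)
    finally show "norm (real n * t (Suc ?k)) \<le> sqrt (t (Suc ?k) / t ?k)"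
      using t_pos[of "Suc ?k"] by simp
  qed
qed

text \<open>By minimality \<open>n * u (m n - 1)\<close> exceeds 1, while \<open>u k\<close> is
  negligible against \<open>t k\<close>. Since \<open>m n\<close> is eventually at least 1, the
  truncated subtraction is a genuine predecessor.\<close>

lemma tail_below_gmean_index: "filterlim (\<lambda>n. real n * t (m n - 1)) at_top sequentially"
proof (subst filterlim_at_top_dense, intro allI)
  fix C :: real
  \<comment> \<open>\<open>D\<close> is positive and exceeds \<open>C\<close>. A ratio bound of
    \<open>1 / D^2\<close> becomes a factor \<open>1 / D\<close> under the root.\<close>
  define D where "D = \<bar>C\<bar> + 1"
  have "D > 0"
    by (simp add: D_def)
  have "\<forall>\<^sub>F k in sequentially. t (Suc k) \<le> (1 / D\<^sup>2) * t k"
    using \<open>D > 0\<close> by (intro ratio_eventually_le) simp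
  then have "\<forall>\<^sub>F k in sequentially. t (Suc (k - 1)) \<le> (1 / D\<^sup>2) * t (k - 1)"
    by (rule eventually_compose_filterlim[OF _ filterlim_minus_const_nat_at_top])
  then have "\<forall>\<^sub>F n in sequentially. t (Suc (m n - 1)) \<le> (1 / D\<^sup>2) * t (m n - 1)"
    using gmean_index_at_top by (rule eventually_compose_filterlim)
  moreover have "\<forall>\<^sub>F n in sequentially. 1 \<le> m n"
    using gmean_index_at_top by (simp add: filterlim_at_top)
  ultimately show "\<forall>\<^sub>F n in sequentially. C < real n * t (m n - 1)"
  proof eventually_elim
    case (elim n)
    let ?k = "m n - 1"
    have "u ?k \<le> sqrt (t ?k * (1 / D\<^sup>2 * t ?k))"
      unfolding u_def using elim t_pos[of ?k] by (intro real_sqrt_le_mono mult_left_mono) auto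
    also have "\<dots> = sqrt ((t ?k / D)\<^sup>2)"
      by (simp add: power2_eq_square)
    also have "\<dots> = t ?k / D"
      using t_pos[of ?k] \<open>D > 0\<close> by simp
    finally have "real n * u ?k \<le> real n * (t ?k / D)"
      by (intro mult_left_mono) auto
    moreover have "1 < real n * u ?k"
      using elim by (intro less_first_below[OF consecutive_gmean_pos consecutive_gmean_lim]) (auto simp: m_def)
    ultimately have "1 < real n * t ?k / D"
      by simp
    then have "D < real n * t ?k"
      using \<open>D > 0\<close> by (simp add: less_divide_eq)
    then show ?case
      by (simp add: D_def)
  qed
qed

text \<open>The quotient is one minus the \<open>n\<close>-th power of
  \<open>(1 - a) / (1 - b)\<close>, where \<open>a = t (m n - 1)\<close> and
  \<open>b = t (m n)\<close>. As \<open>b\<close> is eventually at most \<open>a / 2\<close>, that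
  power is at most \<open>exp (- n * a / 2)\<close>, which vanishes by
  \<open>tail_below_gmean_index\<close>.\<close>

lemma atom_at_gmean_index:
  "(\<lambda>n. ((1 - t (m n)) ^ n - (1 - t (m n - 1)) ^ n) / (1 - t (m n)) ^ n) \<longlonglongrightarrow> 1"
proof -
  have "\<forall>\<^sub>F k in sequentially. t (Suc k) \<le> 1/2 * t k"
    by (rule ratio_eventually_le) simp
  then have "\<forall>\<^sub>F k in sequentially. t (Suc (k - 1)) \<le> 1/2 * t (k - 1)"
    by (rule eventually_compose_filterlim[OF _ filterlim_minus_const_nat_at_top])
  then have h: "\<forall>\<^sub>F n in sequentially. t (Suc (m n - 1)) \<le> 1/2 * t (m n - 1)"
    using gmean_index_at_top by (rule eventually_compose_filterlim)
  have pos: "\<forall>\<^sub>F n in sequentially. 1 \<le> m n"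
    using gmean_index_at_top by (simp add: filterlim_at_top)
  have small: "\<forall>\<^sub>F n in sequentially. t (m n) < 1"
    by (rule eventually_compose_filterlim[OF order_tendstoD(2)[OF t_lim] gmean_index_at_top]) simp
  have "filterlim (\<lambda>n. 1/2 * (real n * t (m n - 1))) at_top sequentially"
    by (intro filterlim_tendsto_pos_mult_at_top[OF tendsto_const _ tail_below_gmean_index]) simp
  then have e: "(\<lambda>n. exp (- (1/2 * (real n * t (m n - 1))))) \<longlonglongrightarrow> 0"
    by (intro filterlim_compose[OF exp_at_bot]) (simp add: filterlim_uminus_at_bot)
  have "(\<lambda>n. ((1 - t (m n - 1)) / (1 - t (m n))) ^ n) \<longlonglongrightarrow> 0"
  proof (rule Lim_null_comparison[OF _ e])
    show "\<forall>\<^sub>F n in sequentially. norm (((1 - t (m n - 1)) / (1 - t (m n))) ^ n)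
        \<le> exp (- (1/2 * (real n * t (m n - 1))))"
      using h pos small
    proof eventually_elim
      case (elim n)
      define a b where "a = t (m n - 1)" and "b = t (m n)"
      have ab: "b \<le> 1/2 * a" "a \<le> 1" "b < 1" "0 < b" "0 < a"
        using elim t_le t_pos by (auto simp: a_def b_def)
      \<comment> \<open>This product is exactly the difference of the two sides of the next
        inequality after multiplying by \<open>1 - b\<close>.\<close>
      have "0 \<le> b * (a - b)"
        using ab by (intro mult_nonneg_nonneg) auto
      then have "(1 - a) / (1 - b) \<le> 1 - (a - b)"
        using ab by (subst pos_divide_le_eq) (auto simp: algebra_simps)
      also have "\<dots> \<le> exp (- (a - b))"
        using exp_ge_add_one_self[of "b - a"] by (simp add: algebra_simps)
      also have "\<dots> \<le> exp (- (1/2 * a))"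
        using ab by simp
      finally have "((1 - a) / (1 - b)) ^ n \<le> exp (- (1/2 * a)) ^ n"
        using ab by (intro power_mono) auto
      also have "\<dots> = exp (- (1/2 * (real n * a)))"
        by (simp flip: exp_of_nat_mult)
      finally show ?case
        using ab by (simp add: a_def b_def)
    qed
  qed
  from tendsto_diff[OF tendsto_const[of 1] this]
  have "(\<lambda>n. 1 - ((1 - t (m n - 1)) / (1 - t (m n))) ^ n) \<longlonglongrightarrow> 1"
    by simp
  moreover have "\<forall>\<^sub>F n in sequentially. 1 - ((1 - t (m n - 1)) / (1 - t (m n))) ^ n =
      ((1 - t (m n)) ^ n - (1 - t (m n - 1)) ^ n) / (1 - t (m n)) ^ n"
    using small by eventually_elim (simp add: power_divide diff_divide_distrib[of "_ ^ _"])
  ultimately show ?thesis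
    by (rule Lim_transform_eventually)
qed

text \<open>The denominator comes arbitrarily close to 0 just after a jump of \<open>m\<close>, so
  smallness of \<open>n * t (m n + 1)\<close> alone is not enough. The relative error is bounded by
  that quantity plus the ratio \<open>t (m n + 1) / t (m n)\<close>, and both vanish.\<close>

lemma atom_above_gmean_index:
  "(\<lambda>n. ((1 - t (Suc (m n))) ^ n - (1 - t (m n)) ^ n) / (1 - (1 - t (m n)) ^ n)) \<longlonglongrightarrow> 1"
proof -
  have "(\<lambda>n. t (Suc (m n)) / t (m n)) \<longlonglongrightarrow> 0"
    using ratio gmean_index_at_top unfolding \<gamma> by (rule filterlim_compose)
  from tendsto_add[OF this tail_above_gmean_index]
  have bound: "(\<lambda>n. t (Suc (m n)) / t (m n) + real n * t (Suc (m n))) \<longlonglongrightarrow> 0"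
    by simp
  \<comment> \<open>Bernoulli bounds the numerator by \<open>n * b\<close>. Comparing
    \<open>(1 - a) ^ n\<close> with \<open>exp (- n * a)\<close>, and hence with
    \<open>1 / (1 + n * a)\<close>, bounds the denominator below by
    \<open>n * a / (1 + n * a)\<close>. The quotient of these bounds is the right-hand side.\<close>
  have ineq: "norm ((1 - (1 - b) ^ n) / (1 - (1 - a) ^ n)) \<le> b / a + real n * b"
    if "0 < a" "a \<le> 1" "0 < b" "b \<le> 1" "n \<ge> 1" for a b :: real and n
  proof -
    have "1 - real n * b \<le> (1 - b) ^ n"
      using Bernoulli_inequality[of "- b" n] that by simp
    then have num: "1 - (1 - b) ^ n \<le> real n * b"
      by simp
    have num0: "0 \<le> 1 - (1 - b) ^ n"
      using that by (simp add: power_le_one)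
    have "1 - a \<le> exp (- a)"
      using exp_ge_add_one_self[of "- a"] by simp
    then have "(1 - a) ^ n \<le> exp (- a) ^ n"
      using that by (intro power_mono) auto
    also have "\<dots> = inverse (exp (real n * a))"
      by (simp add: exp_minus power_inverse exp_of_nat_mult)
    also have "\<dots> \<le> inverse (1 + real n * a)"
      using that by (intro le_imp_inverse_le exp_ge_add_one_self) (simp add: add_pos_nonneg)
    finally have "1 - inverse (1 + real n * a) \<le> 1 - (1 - a) ^ n"
      by simp
    moreover have y: "real n * a > 0"
      using that by simp
    then have "1 - inverse (1 + real n * a) = real n * a / (1 + real n * a)"
      by (simp add: field_simps)
    ultimately have den: "real n * a / (1 + real n * a) \<le> 1 - (1 - a) ^ n"
      by simp
    have dpos: "0 < real n * a / (1 + real n * a)"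
      using y by simp
    have "(1 - (1 - b) ^ n) / (1 - (1 - a) ^ n) \<le> (real n * b) / (real n * a / (1 + real n * a))"
      using num num0 den dpos by (intro frac_le) auto
    also have "\<dots> = b / a + real n * b"
      using that y by (simp add: field_simps)
    finally show ?thesis
      using num0 den dpos by simp
  qed
  have "(\<lambda>n. (1 - (1 - t (Suc (m n))) ^ n) / (1 - (1 - t (m n)) ^ n)) \<longlonglongrightarrow> 0"
    by (intro Lim_null_comparison[OF _ bound] eventually_sequentiallyI[of 1] ineq t_pos t_le)
  from tendsto_diff[OF tendsto_const[of 1] this]
  have "(\<lambda>n. 1 - (1 - (1 - t (Suc (m n))) ^ n) / (1 - (1 - t (m n)) ^ n)) \<longlonglongrightarrow> 1"
    by simp
  moreover have "\<forall>\<^sub>F n in sequentially. 1 - (1 - (1 - t (Suc (m n))) ^ n) / (1 - (1 - t (m n)) ^ n) =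
      ((1 - t (Suc (m n))) ^ n - (1 - t (m n)) ^ n) / (1 - (1 - t (m n)) ^ n)"
  proof (rule eventually_sequentiallyI[of 1])
    fix n :: nat assume "1 \<le> n"
    have "(1 - t (m n)) ^ n < 1"
      using t_pos[of "m n"] t_le[of "m n"] \<open>1 \<le> n\<close> by (intro power_less_one_iff[THEN iffD2]) auto
    then show "1 - (1 - (1 - t (Suc (m n))) ^ n) / (1 - (1 - t (m n)) ^ n) =
      ((1 - t (Suc (m n))) ^ n - (1 - t (m n)) ^ n) / (1 - (1 - t (m n)) ^ n)"
      by (simp add: field_simps)
  qed
  ultimately show ?thesis
    by (rule Lim_transform_eventually)
qed

end

end

section \<open>The law of the maximum and the strict bound on the distribution function\<close>

lemma (in prob_space) prob_sample_max_le:
  assumes indep: "indep_vars (\<lambda>_. count_space UNIV) X {1..}"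
    and cdf: "\<And>i. i \<ge> 1 \<Longrightarrow> cdf (distr M borel (\<lambda>\<omega>. real_of_int (X i \<omega>))) = F"
    and "n \<ge> 1"
  shows "{\<omega> \<in> space M. sample_max X n \<omega> \<le> k} \<in> events"
    and "prob {\<omega> \<in> space M. sample_max X n \<omega> \<le> k} = F (real_of_int k) ^ n"
proof -
  have meas [measurable]: "X i \<in> measurable M (count_space UNIV)" if "i \<ge> 1" for i
    using indep that by (auto simp: indep_vars_def)
  \<comment> \<open>\<open>n \<ge> 1\<close> makes the set under \<open>Max\<close> nonempty, so the
    maximum is bounded exactly when every sample is.\<close>
  have eq: "{\<omega> \<in> space M. sample_max X n \<omega> \<le> k} = (\<Inter>i\<in>{1..n}. X i -` {..k} \<inter> space M)"
    using \<open>n \<ge> 1\<close> by (auto simp: sample_max_def)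
  show "{\<omega> \<in> space M. sample_max X n \<omega> \<le> k} \<in> events"
    unfolding eq using \<open>n \<ge> 1\<close>
    by (intro sets.finite_INT) (auto intro!: measurable_sets[OF meas])
  have "prob {\<omega> \<in> space M. sample_max X n \<omega> \<le> k} = (\<Prod>i\<in>{1..n}. prob (X i -` {..k} \<inter> space M))"
    unfolding eq using \<open>n \<ge> 1\<close> by (intro indep_varsD[OF indep]) auto
  also have "\<dots> = (\<Prod>i\<in>{1..n}. F (real_of_int k))"
  proof (rule prod.cong[OF refl])
    fix i assume "i \<in> {1..n}"
    then have "i \<ge> 1"
      by simp
    have [measurable]: "(\<lambda>\<omega>. real_of_int (X i \<omega>)) \<in> borel_measurable M"
      by (rule measurable_compose[OF meas[OF \<open>i \<ge> 1\<close>]]) simp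
    have "F (real_of_int k) = prob ((\<lambda>\<omega>. real_of_int (X i \<omega>)) -` {..real_of_int k} \<inter> space M)"
      by (simp add: cdf[OF \<open>i \<ge> 1\<close>, symmetric] cdf_def measure_distr)
    also have "(\<lambda>\<omega>. real_of_int (X i \<omega>)) -` {..real_of_int k} = X i -` {..k}"
      by auto
    finally show "prob (X i -` {..k} \<inter> space M) = F (real_of_int k)"
      by simp
  qed
  finally show "prob {\<omega> \<in> space M. sample_max X n \<omega> \<le> k} = F (real_of_int k) ^ n"
    by simp
qed

lemma (in prob_space) prob_sample_max_eq:
  assumes indep: "indep_vars (\<lambda>_. count_space UNIV) X {1..}"
    and cdf: "\<And>i. i \<ge> 1 \<Longrightarrow> cdf (distr M borel (\<lambda>\<omega>. real_of_int (X i \<omega>))) = F"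
    and "n \<ge> 1"
  shows "prob {\<omega> \<in> space M. sample_max X n \<omega> = k} =
    F (real_of_int k) ^ n - F (real_of_int (k - 1)) ^ n"
proof -
  note le = prob_sample_max_le[OF assms]
  have "{\<omega> \<in> space M. sample_max X n \<omega> = k} =
      {\<omega> \<in> space M. sample_max X n \<omega> \<le> k} - {\<omega> \<in> space M. sample_max X n \<omega> \<le> k - 1}"
    by auto
  also have "prob \<dots> = prob {\<omega> \<in> space M. sample_max X n \<omega> \<le> k} -
      prob {\<omega> \<in> space M. sample_max X n \<omega> \<le> k - 1}"
    by (rule finite_measure_Diff[OF le(1) le(1)]) auto
  finally show ?thesis
    by (simp only: le(2)[of k] le(2)[of "k - 1"])
qed

text \<open>Once \<open>F\<close> reaches 1 at \<open>x\<close> it is constant from there on, so no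
  point of increase lies beyond \<open>x\<close> and the support is bounded by
  \<open>x\<close>.\<close>

lemma cdf_less_1_if_support_unbounded:
  assumes mono: "mono F" and le1: "\<And>x. F x \<le> 1" and unbdd: "\<not> bdd_above (df_support F)"
  shows "F x < 1"
proof (rule ccontr)
  assume "\<not> F x < 1"
  then have 1: "F y = 1" if "y \<ge> x" for y
    using monoD[OF mono that] le1[of y] le1[of x] by linarith
  have "y \<le> x" if y: "y \<in> df_support F" for y
  proof (rule ccontr)
    assume "\<not> y \<le> x"
    \<comment> \<open>Radius \<open>y - x\<close> puts the left end of the window at
      \<open>x\<close>, where \<open>F\<close> is already 1.\<close>
    then have "F (y - (y - x)) < F (y + (y - x))"
      using y[unfolded df_support_def, simplified, rule_format, of "y - x"] by simp
    then show False
      using 1[of x] le1[of "2 * y - x"] by (simp add: algebra_simps)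
  qed
  then show False
    using unbdd by (auto simp: bdd_above_def)
qed

section \<open>Transfer from the tail sequence to the maxima\<close>

theorem theorem1p1:
  fixes M :: "'a measure" and X :: "nat \<Rightarrow> 'a \<Rightarrow> int" and F :: "real \<Rightarrow> real" and \<gamma> :: real
  assumes "prob_space M"
    and "prob_space.indep_vars M (\<lambda>_. count_space UNIV) X {1..}"
    and "\<And>i. i \<ge> 1 \<Longrightarrow> cdf (distr M borel (\<lambda>\<omega>. real_of_int (X i \<omega>))) = F"
    and "\<not> bdd_above (df_support F)"
    and "\<gamma> \<in> {0..1}"
    and "(\<lambda>n::nat. (1 - F (real n + 1)) / (1 - F (real n))) \<longlonglongrightarrow> \<gamma>"
  shows "\<exists>(m :: nat \<Rightarrow> nat) (p :: nat \<Rightarrow> real).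
    (\<forall>n. p n \<in> {0..1}) \<and>
    (\<gamma> = 0 \<longrightarrow>
      (\<lambda>n. measure M {\<omega> \<in> space M. sample_max X n \<omega> = int (m n)} / p n) \<longlonglongrightarrow> 1 \<and>
      (\<lambda>n. measure M {\<omega> \<in> space M. sample_max X n \<omega> = int (m n) + 1} / (1 - p n)) \<longlonglongrightarrow> 1 \<and>
      (\<exists>N :: nat \<Rightarrow> nat. strict_mono N \<and>
        filterlim (\<lambda>i. real (N (Suc i)) - real (N i)) at_top sequentially \<and>
        (\<forall>\<^sub>F n in sequentially. n \<notin> range N \<longrightarrow> p (n + 1) \<le> p n) \<and>
        ((\<lambda>n. p (n + 1) - p n) \<longlongrightarrow> 0) (inf sequentially (principal (- range N))))) \<and>
    (0 < \<gamma> \<and> \<gamma> < 1 \<longrightarrow>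
      (\<forall>x::int. (\<lambda>n. measure M {\<omega> \<in> space M. sample_max X n \<omega> \<le> int (m n) + x}
                      / (p n powr (\<gamma> powi x))) \<longlonglongrightarrow> 1)) \<and>
    (\<gamma> = 1 \<longrightarrow>
      (\<forall>x::int. (\<lambda>n. measure M {\<omega> \<in> space M. sample_max X n \<omega> \<le> int (m n) + x}
                      / p n) \<longlonglongrightarrow> 1))"
proof -
  interpret prob_space M by fact
  note le = prob_sample_max_le(2)[OF assms(2,3)] and eq = prob_sample_max_eq[OF assms(2,3)]
  have "X 1 \<in> measurable M (count_space UNIV)"
    using assms(2) by (auto simp: indep_vars_def)
  then have "(\<lambda>\<omega>. real_of_int (X 1 \<omega>)) \<in> borel_measurable M"
    by (rule measurable_compose) simp
  then interpret D: real_distribution "distr M borel (\<lambda>\<omega>. real_of_int (X 1 \<omega>))"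
    by (rule real_distribution_distr)
  have F: "cdf (distr M borel (\<lambda>\<omega>. real_of_int (X 1 \<omega>))) = F"
    by (rule assms(3)) simp
  have F_mono: "mono F"
    using D.cdf_nondecreasing unfolding F by (rule monoI)
  have F_le: "F x \<le> 1" and F_ge: "0 \<le> F x" for x
    using D.cdf_bounded_prob[of x] D.cdf_nonneg[of x] unfolding F by auto
  have F_lim: "(F \<longlongrightarrow> 1) at_top"
    using D.cdf_lim_at_top_prob unfolding F .
  have F_less: "F x < 1" for x
    using F_mono F_le assms(4) by (rule cdf_less_1_if_support_unbounded)
  define t where "t k = 1 - F (real k)" for k
  have t_pos: "t k > 0" and t_le: "t k \<le> 1" for k
    using F_less F_ge by (auto simp: t_def)
  have t_dec: "decseq t"
    using F_mono by (auto simp: t_def decseq_def mono_def)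
  have "(\<lambda>k. 1 - F (real k)) \<longlonglongrightarrow> 1 - 1"
    by (intro tendsto_intros filterlim_compose[OF F_lim filterlim_real_sequentially])
  then have t_lim: "t \<longlonglongrightarrow> 0"
    by (simp add: t_def[abs_def])
  have ratio: "(\<lambda>k. t (Suc k) / t k) \<longlonglongrightarrow> \<gamma>"
    using assms(6) by (simp add: t_def add.commute)
  note t = t_pos t_le t_dec t_lim ratio
  have p01: "(1 - t k) ^ n \<in> {0..1}" for k n
    using t_pos[of k] t_le[of k] by (auto intro: power_le_one)
  show ?thesis
  proof (cases "\<gamma> = 0")
    case True
    define m where "m = first_below (\<lambda>k. sqrt (t k * t (Suc k)))"
    define p where "p n = (1 - t (m n)) ^ n" for n
    have m_top: "filterlim m at_top sequentially"
      unfolding m_def by (rule gmean_index_at_top[OF t True])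
    have "\<forall>\<^sub>F n in sequentially. 1 \<le> m n"
      using m_top by (simp add: filterlim_at_top)
    with eventually_ge_at_top[of 1]
    have "\<forall>\<^sub>F n in sequentially. ((1 - t (m n)) ^ n - (1 - t (m n - 1)) ^ n) / (1 - t (m n)) ^ n =
        prob {\<omega> \<in> space M. sample_max X n \<omega> = int (m n)} / p n"
      by eventually_elim (simp add: eq p_def t_def)
    then have 1: "(\<lambda>n. prob {\<omega> \<in> space M. sample_max X n \<omega> = int (m n)} / p n) \<longlonglongrightarrow> 1"
      by (rule Lim_transform_eventually[OF atom_at_gmean_index[OF t True, folded m_def]])
    have "\<forall>\<^sub>F n in sequentially.
        ((1 - t (Suc (m n))) ^ n - (1 - t (m n)) ^ n) / (1 - (1 - t (m n)) ^ n) =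
        prob {\<omega> \<in> space M. sample_max X n \<omega> = int (m n) + 1} / (1 - p n)"
      using eventually_ge_at_top[of 1]
      by eventually_elim (simp add: eq p_def t_def add.commute)
    then have 2: "(\<lambda>n. prob {\<omega> \<in> space M. sample_max X n \<omega> = int (m n) + 1} / (1 - p n)) \<longlonglongrightarrow> 1"
      by (rule Lim_transform_eventually[OF atom_above_gmean_index[OF t True, folded m_def]])
    obtain N where N: "strict_mono N"
        "filterlim (\<lambda>i. real (N (Suc i)) - real (N i)) at_top sequentially"
        "range N = {n. m (Suc n) \<noteq> m n}"
      using gmean_index_jumps[OF t True, folded m_def] by blast
    \<comment> \<open>Away from jumps the base \<open>1 - t (m n)\<close> is unchanged and only the
      exponent grows by one.\<close>
    have step: "p (n + 1) = (1 - t (m n)) * p n" if "n \<notin> range N" for n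
      using that N(3) by (simp add: p_def)
    have p: "0 \<le> p n" "p n \<le> 1" for n
      using p01[of "m n" n] by (auto simp: p_def)
    have 3: "p (n + 1) \<le> p n" if "n \<notin> range N" for n
      unfolding step[OF that] using p(1) t_pos[of "m n"] t_le[of "m n"]
      by (intro mult_left_le_one_le) auto
    have 4: "((\<lambda>n. p (n + 1) - p n) \<longlongrightarrow> 0) (inf sequentially (principal (- range N)))"
    proof (rule Lim_null_comparison)
      show "\<forall>\<^sub>F n in inf sequentially (principal (- range N)). norm (p (n + 1) - p n) \<le> t (m n)"
        unfolding eventually_inf_principal
      proof (intro always_eventually allI impI)
        fix n assume "n \<in> - range N"
        then have "p (n + 1) - p n = - (t (m n) * p n)"
          using step[of n] by (simp add: algebra_simps)
        then show "norm (p (n + 1) - p n) \<le> t (m n)"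
          using p[of n] t_pos[of "m n"] by (simp add: abs_mult mult_left_le)
      qed
      show "((\<lambda>n. t (m n)) \<longlongrightarrow> 0) (inf sequentially (principal (- range N)))"
        using filterlim_compose[OF t_lim m_top] by (rule tendsto_mono[rotated]) simp
    qed
    have 5: "\<forall>\<^sub>F n in sequentially. n \<notin> range N \<longrightarrow> p (n + 1) \<le> p n"
      using 3 by (intro always_eventually allI impI)
    have 6: "\<forall>n. p n \<in> {0..1}"
      using p by simp
    show ?thesis
      by (intro exI[of _ m] exI[of _ p] conjI impI exI[of _ N] 1 2 N(1,2) 4 5 6)
        (use True in auto)
  next
    \<comment> \<open>One choice of \<open>m\<close> and \<open>p\<close> serves both remaining
      cases, since \<open>\<gamma> powi x\<close> is 1 when \<gamma> is 1.\<close>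
    case False
    then have "\<gamma> > 0"
      using assms(5) by simp
    define m where "m = first_below t"
    define p where "p n = (1 - t (m n)) ^ n" for n
    have m_top: "filterlim m at_top sequentially"
      unfolding m_def by (rule first_below_at_top[OF t_pos t_lim])
    have main: "(\<lambda>n. prob {\<omega> \<in> space M. sample_max X n \<omega> \<le> int (m n) + x}
        / p n powr (\<gamma> powi x)) \<longlonglongrightarrow> 1" for x
    proof -
      \<comment> \<open>From here on \<open>m n + x\<close> is nonnegative, so \<open>nat\<close>
        does not truncate it.\<close>
      have "\<forall>\<^sub>F n in sequentially. nat \<bar>x\<bar> \<le> m n"
        using m_top by (simp add: filterlim_at_top)
      with eventually_ge_at_top[of 1]
      have "\<forall>\<^sub>F n in sequentially.
          (1 - t (nat (int (m n) + x))) ^ n / ((1 - t (m n)) ^ n) powr (\<gamma> powi x) =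
          prob {\<omega> \<in> space M. sample_max X n \<omega> \<le> int (m n) + x} / p n powr (\<gamma> powi x)"
      proof eventually_elim
        case (elim n)
        then have "int (nat (int (m n) + x)) = int (m n) + x"
          by linarith
        then have "real (nat (int (m n) + x)) = real_of_int (int (m n) + x)"
          by (metis of_int_of_nat_eq)
        with elim show ?case
          by (simp add: le p_def t_def)
      qed
      then show ?thesis
        by (rule Lim_transform_eventually[OF power_shift_asymp[OF t \<open>\<gamma> > 0\<close>, of x, folded m_def]])
    qed
    show ?thesis
    proof (rule exI[of _ m], rule exI[of _ p], intro conjI impI allI)
      fix x assume "\<gamma> = 1"
      \<comment> \<open>Nonnegativity lets \<open>p n powr 1\<close> simplify to \<open>p n\<close>,
        also when \<open>p n\<close> is 0.\<close>
      have "0 \<le> p n" for n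
        using p01[of "m n" n] by (simp add: p_def)
      then show "(\<lambda>n. prob {\<omega> \<in> space M. sample_max X n \<omega> \<le> int (m n) + x} / p n) \<longlonglongrightarrow> 1"
        using main[of x] \<open>\<gamma> = 1\<close> by simp
    qed (use False main p01 in \<open>auto simp: p_def\<close>)
  qed
qed

end
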